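(* If $G$ and $H$ are graphs, then $$\mu(G\boxtimes H) \ge \mu(G)\,\mu(H).$$
   Context: All graphs are finite, simple, undirected and connected. For a graph $G$ and $X\subseteq V(G)$, two vertices $x,y\in V(G)$ are $X$-visible if there is a shortest $x,y$-path in $G$ none of whose internal vertices lies in $X$. A set $X\subseteq V(G)$ is a mutual-visibility set if its vertices are pairwise $X$-visible, and the mutual-visibility number $\mu(G)$ is the largest cardinality of a mutual-visibility set of $G$. The strong product $G\boxtimes H$ has vertex set $V(G)\times V(H)$, and two distinct vertices $(g,h)$ and $(g',h')$ are adjacent iff ($g=g'$ or $gg'\in E(G)$) and ($h=h'$ or $hh'\in E(H)$). *)

theory Defs
  imports "Graph_Theory.Graph_Theory"
begin

text \<open>
  A finite simple undirected graph is a \<^locale>\<open>pair_graph\<close> (finite, loop-free, symmetric arc set);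
  an edge \<open>uv\<close> is represented by the two arcs \<open>(u, v)\<close> and \<open>(v, u)\<close>.  The library's
  \<^const>\<open>connected\<close> includes non-emptiness of the vertex set.
\<close>

definition shortest_vpath :: "'a pair_pre_digraph \<Rightarrow> 'a \<Rightarrow> 'a list \<Rightarrow> 'a \<Rightarrow> bool" where
  "shortest_vpath G x p y \<longleftrightarrow>
     vpath p G \<and> hd p = x \<and> last p = y \<and>
     (\<forall>q. vpath q G \<and> hd q = x \<and> last q = y \<longrightarrow> vwalk_length p \<le> vwalk_length q)"

definition visible :: "'a pair_pre_digraph \<Rightarrow> 'a set \<Rightarrow> 'a \<Rightarrow> 'a \<Rightarrow> bool" where
  "visible G X x y \<longleftrightarrow> (\<exists>p. shortest_vpath G x p y \<and> set (butlast (tl p)) \<inter> X = {})"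

definition mutual_visibility_set :: "'a pair_pre_digraph \<Rightarrow> 'a set \<Rightarrow> bool" where
  "mutual_visibility_set G X \<longleftrightarrow> X \<subseteq> pverts G \<and> pairwise (visible G X) X"

definition mutual_visibility_number :: "'a pair_pre_digraph \<Rightarrow> nat" where
  "mutual_visibility_number G = Max (card ` {X. mutual_visibility_set G X})"

definition strong_product ::
    "'a pair_pre_digraph \<Rightarrow> 'b pair_pre_digraph \<Rightarrow> ('a \<times> 'b) pair_pre_digraph"
    (infixr \<open>\<boxtimes>\<close> 70) where
  "G \<boxtimes> H =
     \<lparr> pverts = pverts G \<times> pverts H,
       parcs = {((g, h), (g', h')) | g h g' h'.
         g \<in> pverts G \<and> g' \<in> pverts G \<and> h \<in> pverts H \<and> h' \<in> pverts H \<and>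
         (g, h) \<noteq> (g', h') \<and>
         (g = g' \<or> (g, g') \<in> parcs G) \<and> (h = h' \<or> (h, h') \<in> parcs H)} \<rparr>"

lemma pair_graph_strong_product:
  assumes "pair_graph G" "pair_graph H"
  shows "pair_graph (G \<boxtimes> H)"
proof -
  interpret G: pair_graph G by fact
  interpret H: pair_graph H by fact
  let ?V = "pverts G \<times> pverts H"
  have "finite (?V \<times> ?V)" by simp
  moreover have "parcs (G \<boxtimes> H) \<subseteq> ?V \<times> ?V" by (auto simp: strong_product_def)
  ultimately have "finite (parcs (G \<boxtimes> H))" by (rule rev_finite_subset)
  moreover have "(b, a) \<in> parcs G" if "(a, b) \<in> parcs G" for a b
    using G.sym_arcs that by (auto simp: symmetric_def dest: symD)
  moreover have "(b, a) \<in> parcs H" if "(a, b) \<in> parcs H" for a b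
    using H.sym_arcs that by (auto simp: symmetric_def dest: symD)
  ultimately show ?thesis
    by unfold_locales (auto simp: strong_product_def symmetric_def intro!: symI)
qed

lemma mutual_visibility_sets_finite_nonempty:
  assumes "pair_graph G"
  shows "finite {X. mutual_visibility_set G X}" "{X. mutual_visibility_set G X} \<noteq> {}"
proof -
  interpret pair_graph G by fact
  have "{X. mutual_visibility_set G X} \<subseteq> Pow (pverts G)"
    by (auto simp: mutual_visibility_set_def)
  then show "finite {X. mutual_visibility_set G X}"
    by (rule finite_subset) simp
  have "mutual_visibility_set G {}" by (simp add: mutual_visibility_set_def)
  then show "{X. mutual_visibility_set G X} \<noteq> {}" by blast
qed

end

theory Submission
  imports Defs
begin

text \<open>
  If \<open>X\<close> and \<open>Y\<close> are mutual-visibility sets of \<open>G\<close> and \<open>H\<close>, then \<open>X \<times> Y\<close> is one of \<open>G \<boxtimes> H\<close>.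
  Given \<open>X\<close>- and \<open>Y\<close>-visibility witnesses of lengths \<open>a\<close> and \<open>b\<close>, traverse them simultaneously,
  waiting at the end of the shorter one.  The resulting path has length \<open>max a b\<close>, which is optimal
  because walks project to the factors.  The coordinate that moves all the time is, at every
  internal vertex, internal to its own witness, and so keeps that vertex out of \<open>X \<times> Y\<close>.
\<close>

lemma vwalk_arcs_conv_zip: "vwalk_arcs p = zip p (tl p)"
  by (induct p rule: vwalk_arcs.induct) auto

text \<open>The path in the product is built position by position, so walks are handled through
  indices.\<close>

lemma vwalk_conv_nth:
  "vwalk p G \<longleftrightarrow> p \<noteq> [] \<and> (\<forall>i<length p. p ! i \<in> verts G) \<and>
     (\<forall>i. Suc i < length p \<longrightarrow> (p ! i, p ! Suc i) \<in> arcs_ends G)"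
proof -
  have "set (vwalk_arcs p) = {(p ! i, p ! Suc i) | i. Suc i < length p}"
    unfolding vwalk_arcs_conv_zip set_zip by (force simp: nth_tl)
  moreover have "set p \<subseteq> verts G \<longleftrightarrow> (\<forall>i<length p. p ! i \<in> verts G)"
    by (auto simp: subset_iff in_set_conv_nth)
  ultimately show ?thesis by (auto simp: vwalk_def)
qed

text \<open>The two strict bounds cut off the first and the last position; for lists of length at
  most 1 both sides are empty.\<close>

lemma set_butlast_tl_conv_nth:
  "set (butlast (tl p)) = {p ! i | i. 0 < i \<and> Suc i < length p}"
proof -
  have "set (butlast (tl p)) = {p ! Suc i | i. Suc (Suc i) < length p}"
    unfolding set_conv_nth by (rule Collect_cong, rule ex_cong1, auto simp: nth_butlast nth_tl)
  also have "\<dots> = {p ! i | i. 0 < i \<and> Suc i < length p}"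
    by (auto simp: gr0_conv_Suc)
  finally show ?thesis .
qed

lemma length_vwalk_to_vpath_le:
  assumes "vwalk p G"
  shows "length (vwalk_to_vpath p) \<le> length p"
proof -
  have "length (vwalk_to_vpath p) = card (set (vwalk_to_vpath p))"
    using vwalk_to_vpath_vpath[OF assms] by (auto simp: vpath_def distinct_card)
  also have "\<dots> \<le> card (set p)"
    by (intro card_mono) (auto intro: vwalk_to_vpath_subset)
  also have "\<dots> \<le> length p" by (rule card_length)
  finally show ?thesis .
qed

text \<open>Applied to \<open>fst\<close> and \<open>snd\<close>, this bounds distances in the
  product from below. An arc may collapse to a vertex, which only shortens the image. Since
  \<open>shortest_vpath\<close> compares paths with paths, the image walk is finally reduced to a
  path.\<close>

lemma vwalk_weak_hom_image:
  assumes "vwalk w K"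
    and verts: "\<And>u. u \<in> verts K \<Longrightarrow> f u \<in> verts G"
    and arcs: "\<And>u v. (u, v) \<in> arcs_ends K \<Longrightarrow>
                 f u \<in> verts G \<and> (f u = f v \<or> (f u, f v) \<in> arcs_ends G)"
  shows "\<exists>q. vpath q G \<and> hd q = f (hd w) \<and> last q = f (last w) \<and> length q \<le> length w"
proof -
  have "\<exists>q. vwalk q G \<and> hd q = f (hd w) \<and> last q = f (last w) \<and> length q \<le> length w"
    using \<open>vwalk w K\<close>
  proof (induct w rule: vwalk_induct)
    case (Base u)
    then show ?case using verts by (intro exI[of _ "[f u]"]) auto
  next
    case (Cons u v es)
    then obtain q where q: "vwalk q G" "hd q = f v" "last q = f (last (v # es))"
      "length q \<le> length (v # es)" by auto
    show ?case
    proof (cases "f u = f v")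
      \<comment> \<open>A collapsed arc contributes nothing: the image of the tail already starts at
        \<open>f u\<close>.\<close>
      case True
      with q show ?thesis by (intro exI[of _ q]) auto
    next
      case False
      with arcs[OF Cons(1)] q have "vwalk (f u # q) G" by (intro vwalk_consI) auto
      moreover from q have "q \<noteq> []" by auto
      ultimately show ?thesis using q by (intro exI[of _ "f u # q"]) auto
    qed
  qed
  then obtain q where "vwalk q G" "hd q = f (hd w)" "last q = f (last w)" "length q \<le> length w"
    by blast
  then show ?thesis
    using length_vwalk_to_vpath_le[of q G]
    by (intro exI[of _ "vwalk_to_vpath q"])
      (auto simp: vwalk_to_vpath_hd vwalk_to_vpath_last intro: vwalk_to_vpath_vpath)
qed

text \<open>Distinct pairs in \<open>X \<times> Y\<close> may agree in one coordinate, a case on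
  which \<open>pairwise\<close> is silent in that factor. The one-vertex path has no internal
  vertices.\<close>

lemma visible_refl:
  assumes "x \<in> pverts G"
  shows "visible G X x x"
  using assms unfolding visible_def shortest_vpath_def
  by (intro exI[of _ "[x]"]) (auto simp: vpath_self)

lemma visible_strong_product:
  assumes "visible G X g g'" and "visible H Y h h'" and "(g, h) \<noteq> (g', h')"
  shows "visible (G \<boxtimes> H) (X \<times> Y) (g, h) (g', h')"
proof -
  obtain p where p: "shortest_vpath G g p g'" "set (butlast (tl p)) \<inter> X = {}"
    using assms(1) by (auto simp: visible_def)
  obtain q where q: "shortest_vpath H h q h'" "set (butlast (tl q)) \<inter> Y = {}"
    using assms(2) by (auto simp: visible_def)
  \<comment> \<open>These count arcs, so \<open>p ! a\<close> and \<open>q ! b\<close> are the final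
    vertices.\<close>
  define a b where "a = length p - 1" and "b = length q - 1"
  define n where "n = max a b"
  \<comment> \<open>Capping the index by \<open>min\<close> makes the shorter path wait at its
    end.\<close>
  define w where "w = map (\<lambda>i. (p ! min i a, q ! min i b)) [0..<Suc n]"
  have vp: "vwalk p G" "distinct p" "hd p = g" "last p = g'"
    and vq: "vwalk q H" "distinct q" "hd q = h" "last q = h'"
    using p(1) q(1) by (auto simp: shortest_vpath_def vpath_def)
  have lp: "length p = Suc a" and lq: "length q = Suc b"
    using vp(1) vq(1) by (auto simp: a_def b_def vwalk_def)
  have ends: "p ! 0 = g" "p ! a = g'" "q ! 0 = h" "q ! b = h'"
    using vp vq by (auto simp: a_def b_def vwalk_def hd_conv_nth last_conv_nth)
  have pv: "p ! i \<in> pverts G" if "i \<le> a" for i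
    using vp(1) that lp by (auto simp: vwalk_conv_nth)
  have qv: "q ! i \<in> pverts H" if "i \<le> b" for i
    using vq(1) that lq by (auto simp: vwalk_conv_nth)
  have pa: "(p ! i, p ! Suc i) \<in> parcs G" if "i < a" for i
    using vp(1) that lp by (auto simp: vwalk_conv_nth)
  have qa: "(q ! i, q ! Suc i) \<in> parcs H" if "i < b" for i
    using vq(1) that lq by (auto simp: vwalk_conv_nth)
  have pd: "p ! i = p ! j \<longleftrightarrow> i = j" if "i \<le> a" "j \<le> a" for i j
    using vp(2) that lp by (auto simp: nth_eq_iff_index_eq)
  have qd: "q ! i = q ! j \<longleftrightarrow> i = j" if "i \<le> b" "j \<le> b" for i j
    using vq(2) that lq by (auto simp: nth_eq_iff_index_eq)
  have lw: "length w = Suc n" by (simp add: w_def)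
  have wi: "w ! i = (p ! min i a, q ! min i b)" if "i \<le> n" for i
    using that by (auto simp: w_def simp del: upt_Suc)
  \<comment> \<open>As \<open>n\<close> is \<open>a\<close> or \<open>b\<close>, one of the two caps
    never takes effect up to \<open>n\<close>, and that coordinate alone determines the index. This
    also keeps consecutive vertices of \<open>w\<close> distinct, as adjacency in the product
    requires.\<close>
  have w_inj: "i = j" if "i \<le> n" "j \<le> n" "w ! i = w ! j" for i j
  proof -
    have "min i a = min j a" "min i b = min j b"
      using that by (auto simp: wi pd qd)
    then show ?thesis using that by (auto simp: n_def min_def max_def split: if_splits)
  qed
  have w_arc: "(w ! i, w ! Suc i) \<in> parcs (G \<boxtimes> H)" if "i < n" for i
  proof -
    have "p ! min i a = p ! min (Suc i) a \<or> (p ! min i a, p ! min (Suc i) a) \<in> parcs G"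
      using pa[of i] by (cases "i < a") (auto simp: min_def)
    moreover have "q ! min i b = q ! min (Suc i) b \<or> (q ! min i b, q ! min (Suc i) b) \<in> parcs H"
      using qa[of i] by (cases "i < b") (auto simp: min_def)
    moreover have "w ! i \<noteq> w ! Suc i" using w_inj[of i "Suc i"] that by auto
    ultimately show ?thesis
      using that pv[of "min i a"] pv[of "min (Suc i) a"] qv[of "min i b"] qv[of "min (Suc i) b"]
      by (auto simp: strong_product_def wi)
  qed
  have vw: "vpath w (G \<boxtimes> H)"
  proof (rule vpathI)
    show "distinct w" using w_inj lw by (auto simp: distinct_conv_nth less_Suc_eq_le)
    show "vwalk w (G \<boxtimes> H)" using lw w_arc
      by (auto simp: vwalk_conv_nth less_Suc_eq_le wi strong_product_def pv qv)
  qed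
  have "w \<noteq> []" using lw by auto
  have hl: "hd w = (g, h)" "last w = (g', h')"
    using lw wi[of 0] wi[of n] ends \<open>w \<noteq> []\<close>
    by (auto simp: hd_conv_nth last_conv_nth n_def min_def max_def)
  \<comment> \<open>Both projections of a competitor \<open>r\<close> connect the ends of
    \<open>p\<close> and of \<open>q\<close>, so \<open>r\<close> has at least \<open>a\<close> and
    at least \<open>b\<close> arcs.\<close>
  have minimal: "n \<le> length r - 1"
    if r: "vpath r (G \<boxtimes> H)" "hd r = (g, h)" "last r = (g', h')" for r
  proof -
    have vr: "vwalk r (G \<boxtimes> H)" using r(1) by auto
    obtain s where s: "vpath s G" "hd s = g" "last s = g'" "length s \<le> length r"
      using vwalk_weak_hom_image[OF vr, of fst "with_proj G"] r(2,3)
      by (auto simp: strong_product_def)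
    obtain t where t: "vpath t H" "hd t = h" "last t = h'" "length t \<le> length r"
      using vwalk_weak_hom_image[OF vr, of snd "with_proj H"] r(2,3)
      by (auto simp: strong_product_def)
    have "vwalk_length p \<le> vwalk_length s" "vwalk_length q \<le> vwalk_length t"
      using p(1) q(1) s(1-3) t(1-3) unfolding shortest_vpath_def by blast+
    then have "a \<le> length r - 1" "b \<le> length r - 1"
      using s(4) t(4) lp lq by simp_all
    then show ?thesis by (simp add: n_def)
  qed
  have internal: "w ! i \<notin> X \<times> Y" if "0 < i" "i < n" for i
  proof (cases "a \<ge> b")
    case True
    \<comment> \<open>Here \<open>n = a\<close>, so \<open>i\<close> lies strictly inside
      \<open>p\<close>. The first coordinate alone avoids \<open>X\<close>; the second may be
      waiting at \<open>h'\<close>, possibly in \<open>Y\<close>.\<close>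
    then have "p ! i \<in> set (butlast (tl p))"
      using that lp by (auto simp: set_butlast_tl_conv_nth n_def)
    then show ?thesis using True that p(2) by (auto simp: wi n_def min_def)
  next
    case False
    then have "q ! i \<in> set (butlast (tl q))"
      using that lq by (auto simp: set_butlast_tl_conv_nth n_def)
    then show ?thesis using False that q(2) by (auto simp: wi n_def min_def)
  qed
  have "shortest_vpath (G \<boxtimes> H) (g, h) w (g', h')"
    using vw hl minimal lw by (auto simp: shortest_vpath_def)
  moreover have "set (butlast (tl w)) \<inter> X \<times> Y = {}"
  proof (rule equals0I, elim IntE)
    fix v assume "v \<in> set (butlast (tl w))" "v \<in> X \<times> Y"
    then obtain i where "v = w ! i" "0 < i" "i < n"
      unfolding set_butlast_tl_conv_nth lw by auto
    with \<open>v \<in> X \<times> Y\<close> internal[of i] show False by simp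
  qed
  ultimately show ?thesis unfolding visible_def by (intro exI[of _ w] conjI)
qed

lemma mutual_visibility_set_Times:
  assumes "mutual_visibility_set G X" and "mutual_visibility_set H Y"
  shows "mutual_visibility_set (G \<boxtimes> H) (X \<times> Y)"
proof -
  have "visible G X x x'" if "x \<in> X" "x' \<in> X" for x x'
    using assms(1) that visible_refl[of x G X]
    by (cases "x = x'") (auto simp: mutual_visibility_set_def pairwise_def)
  moreover have "visible H Y y y'" if "y \<in> Y" "y' \<in> Y" for y y'
    using assms(2) that visible_refl[of y H Y]
    by (cases "y = y'") (auto simp: mutual_visibility_set_def pairwise_def)
  ultimately have "pairwise (visible (G \<boxtimes> H) (X \<times> Y)) (X \<times> Y)"
    by (auto simp: pairwise_def intro!: visible_strong_product)
  then show ?thesis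
    using assms by (auto simp: mutual_visibility_set_def strong_product_def)
qed

lemma mutual_visibility_number_attained:
  assumes "pair_graph G"
  obtains X where "mutual_visibility_set G X" and "card X = mutual_visibility_number G"
proof -
  have "Max (card ` {X. mutual_visibility_set G X}) \<in> card ` {X. mutual_visibility_set G X}"
    using mutual_visibility_sets_finite_nonempty[OF assms] by (intro Max_in) auto
  then show thesis using that by (auto simp: mutual_visibility_number_def)
qed

theorem theorem4p6:
  fixes G :: "'a pair_pre_digraph" and H :: "'b pair_pre_digraph"
  assumes "pair_graph G" and "connected G"
    and "pair_graph H" and "connected H"
  shows "mutual_visibility_number (G \<boxtimes> H)
           \<ge> mutual_visibility_number G * mutual_visibility_number H"
proof -
  obtain X where X: "mutual_visibility_set G X" "card X = mutual_visibility_number G"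
    using mutual_visibility_number_attained[OF assms(1)] .
  obtain Y where Y: "mutual_visibility_set H Y" "card Y = mutual_visibility_number H"
    using mutual_visibility_number_attained[OF assms(3)] .
  \<comment> \<open>The product of two optimal sets is one candidate in the maximum for the product
    graph.\<close>
  have "card (X \<times> Y) \<le> mutual_visibility_number (G \<boxtimes> H)"
    unfolding mutual_visibility_number_def
    using mutual_visibility_sets_finite_nonempty(1)[OF pair_graph_strong_product[OF assms(1,3)]]
      mutual_visibility_set_Times[OF X(1) Y(1)]
    by (intro Max_ge) auto
  then show ?thesis using X(2) Y(2) by (simp add: card_cartesian_product)
qed

end
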